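(* The increments of the Markov chain $\{X_n:n\in\mathbb{N}\}$ with respect to the Kendall convolution $\triangle_1$, with unit step $\delta_1$, are not independent. In particular, for each $k\in\mathbb{N}$ the random variables $X_k$ and $X_{k+1}-X_k$ are not independent.
   Context: $\mathbb{N}=\{1,2,\dots\}$. $T_b\lambda$ denotes the law of $b\theta$ for $\theta\sim\lambda$. $\pi_2$ is the Pareto distribution with density $2x^{-3}\mathbf{1}_{(1,\infty)}(x)$. The Kendall convolution $\triangle_1$ is the commutative, associative operation on Borel probability measures on $[0,\infty)$ determined by $$\delta_a\triangle_1\delta_b=\Bigl(1-\frac ab\Bigr)\delta_b+\frac ab\,T_b\pi_2\quad(0\le a\le b,\ b>0),\qquad\delta_0\triangle_1\delta_0=\delta_0,$$ and $(\lambda_1\triangle_1\lambda_2)(A)=\int\!\int(\delta_x\triangle_1\delta_y)(A)\,\lambda_1(dx)\lambda_2(dy)$. The Markov chain (random walk) with respect to $\triangle_1$ with unit step $\delta_1$ is the Markov chain with $X_0=0$ and transition probabilities $P(X_n\in A\mid X_k=x)=\bigl(\delta_x\triangle_1\delta_1^{\triangle_1(n-k)}\bigr)(A)$ for $k<n$; in particular $X_1\sim\delta_1$. The increments are the ordinary differences $X_{n+1}-X_n$.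
   Formalization: The second claim is proved for each k ≥ 2 only; for k = 1 it is false, since X_1 = 1 almost surely and a constant is independent of X_2 − X_1. *)

theory Defs
  imports "HOL-Probability.Probability"
begin

definition pareto2 :: "real measure" where
  "pareto2 = density lborel (\<lambda>x. ennreal (2 / x ^ 3 * indicator {1<..} x))"

definition dilation :: "real \<Rightarrow> real measure \<Rightarrow> real measure" where
  "dilation b \<mu> = distr \<mu> borel (\<lambda>x. b * x)"

(* The law delta_x tri delta_y, written as the mixture of T_b pi_2 (with probability a/b) and
   delta_b, where a = min x y and b = max x y; see emeasure_kendall_dirac.  For x = y = 0
   the convention 0 / 0 = 0 yields delta_0.  Arguments outside [0, infinity) do not matter;
   bernoulli_pmf clamps its parameter to [0, 1], so the kernel is a probability kernel on all
   pairs of reals. *)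
definition kendall_dirac :: "real \<Rightarrow> real \<Rightarrow> real measure" where
  "kendall_dirac x y =
     measure_pmf (bernoulli_pmf (min x y / max x y)) \<bind>
       (\<lambda>c. if c then dilation (max x y) pareto2 else return borel (max x y))"

(* Measures on [0, infinity) are represented by Borel measures on the reals. *)
definition kendall_conv :: "real measure \<Rightarrow> real measure \<Rightarrow> real measure" (infixl "\<triangle>" 70) where
  "\<mu> \<triangle> \<nu> = \<mu> \<bind> (\<lambda>x. \<nu> \<bind> (\<lambda>y. kendall_dirac x y))"

(* delta_0 is the neutral element, so it is the zeroth power. *)
primrec kendall_power :: "real measure \<Rightarrow> nat \<Rightarrow> real measure" where
  "kendall_power \<nu> 0 = return borel 0"
| "kendall_power \<nu> (Suc n) = kendall_power \<nu> n \<triangle> \<nu>"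

definition history :: "'a measure \<Rightarrow> (nat \<Rightarrow> 'a \<Rightarrow> real) \<Rightarrow> nat \<Rightarrow> 'a measure" where
  "history M X k = sigma (space M) (\<Union>i\<in>{..k}. {X i -` A \<inter> space M | A. A \<in> sets borel})"

(* The assumption transition contains the Markov property together with the form of the
   transition probabilities:
   P (X n in A | X 0, ..., X k) = (delta_(X k) tri step^(n - k)) (A) almost surely. *)
locale kendall_walk = prob_space M for M :: "'a measure" +
  fixes step :: "real measure" and X :: "nat \<Rightarrow> 'a \<Rightarrow> real"
  assumes random_variable: "X n \<in> borel_measurable M"
    and start: "AE \<omega> in M. X 0 \<omega> = 0"
    and transition: "k < n \<Longrightarrow> A \<in> sets borel \<Longrightarrow>
      AE \<omega> in M. real_cond_exp M (history M X k) (indicator (X n -` A \<inter> space M)) \<omega> =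
        measure (return borel (X k \<omega>) \<triangle> kendall_power step (n - k)) A"

lemma prob_space_pareto2: "prob_space pareto2"
proof
  have "(\<integral>\<^sup>+x. ennreal (2 / x ^ 3) * indicator {1..} x \<partial>lborel) = ennreal (0 - (- 1 / 1 ^ 2))"
  proof (rule nn_integral_FTC_atLeast[where F="\<lambda>x. - 1 / x ^ 2"])
    show "DERIV (\<lambda>x::real. - 1 / x ^ 2) x :> 2 / x ^ 3" if "1 \<le> x" for x
      using that by (auto intro!: derivative_eq_intros simp: field_simps eval_nat_numeral)
    show "((\<lambda>x::real. - 1 / x ^ 2) \<longlongrightarrow> 0) at_top"
      by (intro tendsto_divide_0[OF tendsto_const] filterlim_at_top_imp_at_infinity
        filterlim_pow_at_top filterlim_ident) simp
  qed auto
  moreover have "(\<integral>\<^sup>+x. ennreal (2 / x ^ 3 * indicator {1<..} x) \<partial>lborel) =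
      (\<integral>\<^sup>+x. ennreal (2 / x ^ 3) * indicator {1..} x \<partial>lborel)"
    by (rule nn_integral_cong_AE, use AE_lborel_singleton[of "1::real"] in eventually_elim)
       (auto simp: indicator_def)
  ultimately show "emeasure pareto2 (space pareto2) = 1"
    by (simp add: pareto2_def emeasure_density)
qed

lemma sets_pareto2 [simp, measurable_cong]: "sets pareto2 = sets borel"
  by (simp add: pareto2_def)

lemma space_pareto2 [simp]: "space pareto2 = UNIV"
  by (simp add: pareto2_def)

lemma dilation_measurable [measurable]:
  "(\<lambda>b. dilation b pareto2) \<in> borel \<rightarrow>\<^sub>M subprob_algebra borel"
proof -
  have "pareto2 \<in> space (subprob_algebra borel)"
    using prob_space_pareto2 by (simp add: space_subprob_algebra prob_space_imp_subprob_space)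
  then have [measurable]: "(\<lambda>b. pareto2) \<in> borel \<rightarrow>\<^sub>M subprob_algebra borel"
    by simp
  show ?thesis
    unfolding dilation_def by (rule measurable_distr2[where M=borel]) measurable
qed

lemma kernel_pieces:
  "(\<lambda>c. if c then dilation b pareto2 else return borel b) \<in>
     measurable (measure_pmf p) (subprob_algebra borel)"
proof -
  have "dilation b pareto2 \<in> space (subprob_algebra borel)"
    using measurable_space[OF dilation_measurable, of b] by simp
  moreover have "return borel b \<in> space (subprob_algebra borel)"
    using measurable_space[OF return_measurable, of b borel] by simp
  ultimately show ?thesis
    by (auto simp: measurable_def)
qed

lemma sets_kendall_dirac [simp, measurable_cong]: "sets (kendall_dirac x y) = sets borel"
  unfolding kendall_dirac_def
  by (rule sets_bind) (auto simp: dilation_def)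

lemma emeasure_kendall_dirac_aux:
  assumes "A \<in> sets borel" and p: "p = min 1 (max 0 (min x y / max x y))"
  shows "emeasure (kendall_dirac x y) A =
    emeasure (dilation (max x y) pareto2) A * ennreal p +
    emeasure (return borel (max x y)) A * ennreal (1 - p)"
proof -
  have "bernoulli_pmf (min x y / max x y) = bernoulli_pmf p"
    by (rule pmf_eqI) (auto simp: bernoulli_pmf.rep_eq p split: bool.split)
  moreover have "0 \<le> p" "p \<le> 1"
    by (auto simp: p)
  ultimately show ?thesis
    unfolding kendall_dirac_def
    by (subst emeasure_bind[OF _ kernel_pieces assms(1)]) auto
qed

lemma emeasure_kendall_dirac:
  assumes "0 \<le> a" "a \<le> b" "0 < b" "A \<in> sets borel"
  shows "emeasure (kendall_dirac a b) A =
    ennreal (1 - a / b) * emeasure (return borel b) A +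
    ennreal (a / b) * emeasure (dilation b pareto2) A"
  using assms
  by (subst emeasure_kendall_dirac_aux[OF _ refl]) (auto simp: max_def min_def mult.commute add.commute)

lemma kendall_dirac_commute: "kendall_dirac x y = kendall_dirac y x"
  unfolding kendall_dirac_def min.commute[of x] max.commute[of x] ..

lemma measurable_kendall_dirac [measurable]:
  "(\<lambda>(x, y). kendall_dirac x y) \<in> borel \<Otimes>\<^sub>M borel \<rightarrow>\<^sub>M subprob_algebra borel"
proof (rule measurable_subprob_algebra)
  fix z :: "real \<times> real"
  show "subprob_space (case z of (x, y) \<Rightarrow> kendall_dirac x y)"
    by (auto simp: kendall_dirac_def split: prod.split
        intro!: subprob_space_bind[OF _ kernel_pieces] measure_pmf.subprob_space_axioms)
next
  fix A :: "real set" assume A [measurable]: "A \<in> sets borel"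
  have [measurable]: "(\<lambda>b. emeasure (dilation b pareto2) A) \<in> borel_measurable borel"
    by (rule measurable_compose[OF dilation_measurable measurable_emeasure_subprob_algebra[OF A]])
  have [measurable]: "(\<lambda>b. emeasure (return borel b) A) \<in> borel_measurable (borel :: real measure)"
    by simp
  show "(\<lambda>z. emeasure (case z of (x, y) \<Rightarrow> kendall_dirac x y) A) \<in> borel_measurable (borel \<Otimes>\<^sub>M borel)"
    unfolding split_beta emeasure_kendall_dirac_aux[OF A refl] by measurable
qed (auto split: prod.split)

lemma measurable_kendall_dirac_snd: "kendall_dirac x \<in> borel \<rightarrow>\<^sub>M subprob_algebra borel"
  using measurable_Pair2[OF measurable_kendall_dirac, of x] by simp

lemma measurable_bind_kendall_dirac:
  assumes "prob_space \<nu>" "sets \<nu> = sets borel"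
  shows "(\<lambda>x. \<nu> \<bind> kendall_dirac x) \<in> borel \<rightarrow>\<^sub>M subprob_algebra borel"
proof (rule measurable_bind'[where N=borel])
  show "(\<lambda>x. \<nu>) \<in> borel \<rightarrow>\<^sub>M subprob_algebra borel"
    using assms by (simp add: space_subprob_algebra prob_space_imp_subprob_space)
qed (rule measurable_kendall_dirac)

lemma emeasure_kendall_conv:
  assumes "prob_space \<mu>" "sets \<mu> = sets borel" "prob_space \<nu>" "sets \<nu> = sets borel"
    and A: "A \<in> sets borel"
  shows "emeasure (\<mu> \<triangle> \<nu>) A = (\<integral>\<^sup>+x. \<integral>\<^sup>+y. emeasure (kendall_dirac x y) A \<partial>\<nu> \<partial>\<mu>)"
proof -
  note m = measurable_cong_sets[OF assms(2) refl] measurable_cong_sets[OF assms(4) refl]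
  have "emeasure (\<mu> \<triangle> \<nu>) A = (\<integral>\<^sup>+x. emeasure (\<nu> \<bind> kendall_dirac x) A \<partial>\<mu>)"
    unfolding kendall_conv_def using assms
    by (intro emeasure_bind[where N=borel])
       (auto simp: m measurable_bind_kendall_dirac prob_space.not_empty)
  also have "\<dots> = (\<integral>\<^sup>+x. \<integral>\<^sup>+y. emeasure (kendall_dirac x y) A \<partial>\<nu> \<partial>\<mu>)"
    using assms
    by (intro nn_integral_cong emeasure_bind[where N=borel])
       (auto simp: m measurable_kendall_dirac_snd prob_space.not_empty)
  finally show ?thesis .
qed

lemma kendall_conv_return: "return borel x \<triangle> return borel y = kendall_dirac x y"
  unfolding kendall_conv_def
  by (subst bind_return[where N=borel], rule measurable_bind_kendall_dirac)
     (auto simp: prob_space_return bind_return[OF measurable_kendall_dirac_snd])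

lemma kendall_dirac_0: "0 \<le> b \<Longrightarrow> kendall_dirac 0 b = return borel b"
  by (rule measure_eqI) (auto simp: emeasure_kendall_dirac_aux[OF _ refl] max_def min_def)

lemma subalgebra_history:
  assumes "\<And>n. X n \<in> borel_measurable M"
  shows "subalgebra M (history M X k)"
  unfolding subalgebra_def history_def
  using assms by (auto simp: space_measure_of_conv sets_measure_of_conv measurable_sets
      intro!: sets.sigma_sets_subset)

lemma kendall_walk_X1:
  assumes "kendall_walk M (return borel 1) X"
  shows "AE \<omega> in M. X 1 \<omega> = 1"
proof -
  interpret kendall_walk M "return borel 1" X by fact
  note [measurable] = random_variable
  interpret F: finite_measure_subalgebra M "history M X 0"
    by standard (rule subalgebra_history[OF random_variable])
  let ?A = "X 1 -` {1} \<inter> space M"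
  have A: "?A \<in> events" by measurable
  have "AE \<omega> in M. real_cond_exp M (history M X 0) (indicator ?A) \<omega> = 1"
    using transition[of 0 1 "{1}", simplified] start
  proof eventually_elim
    case (elim \<omega>)
    then show ?case
      by (simp add: kendall_conv_return kendall_dirac_0 measure_def)
  qed
  then have "(\<integral>\<omega>. real_cond_exp M (history M X 0) (indicator ?A) \<omega> \<partial>M) = (\<integral>\<omega>. 1 \<partial>M)"
    by (intro integral_cong_AE) auto
  moreover have "(\<integral>\<omega>. real_cond_exp M (history M X 0) (indicator ?A) \<omega> \<partial>M) = prob ?A"
    using A by (subst F.real_cond_exp_int(2)) (auto simp: emeasure_eq_measure)
  ultimately have "prob ?A = 1"
    by (simp add: prob_space)
  then show ?thesis
    using A by (subst (asm) prob_eq_1) auto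
qed

(* X 1 is almost surely constant, so for k = 1 the variables X k and X (k + 1) - X k are
   independent; dependence can only be claimed for k at least 2. *)
lemma kendall_walk_indep_1:
  assumes "kendall_walk M (return borel 1) X"
  shows "prob_space.indep_var M borel (X 1) borel (\<lambda>\<omega>. X (1 + 1) \<omega> - X 1 \<omega>)"
proof -
  interpret kendall_walk M "return borel 1" X by fact
  note [measurable] = random_variable
  let ?Y = "\<lambda>\<omega>. X (1 + 1) \<omega> - X 1 \<omega>"
  show ?thesis
    unfolding indep_var_eq
  proof (intro conjI indep_set_sigma_sets Int_stableI)
    show "indep_set {X 1 -` A \<inter> space M |A. A \<in> sets borel} {?Y -` A \<inter> space M |A. A \<in> sets borel}"
    proof (safe intro!: indep_setI)
      fix A B :: "real set" assume [measurable]: "A \<in> sets borel" "B \<in> sets borel"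
      show "X 1 -` A \<inter> space M \<in> events" "?Y -` B \<inter> space M \<in> events"
        by measurable
      have X: "AE \<omega> in M. X 1 \<omega> \<in> A \<longleftrightarrow> 1 \<in> A"
        using kendall_walk_X1[OF assms] by eventually_elim simp
      have 1: "prob (X 1 -` A \<inter> space M \<inter> (?Y -` B \<inter> space M)) =
          prob (if 1 \<in> A then ?Y -` B \<inter> space M else {})"
        using X by (intro finite_measure_eq_AE) (auto elim!: eventually_mono)
      have 2: "prob (X 1 -` A \<inter> space M) = prob (if 1 \<in> A then space M else {})"
        using X by (intro finite_measure_eq_AE) (auto elim!: eventually_mono)
      show "prob (X 1 -` A \<inter> space M \<inter> (?Y -` B \<inter> space M)) =
          prob (X 1 -` A \<inter> space M) * prob (?Y -` B \<inter> space M)"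
        unfolding 1 2 by (simp add: prob_space)
    qed
  next
    fix a b assume "a \<in> {X 1 -` A \<inter> space M |A. A \<in> sets borel}" "b \<in> {X 1 -` A \<inter> space M |A. A \<in> sets borel}"
    then obtain A B where "a = X 1 -` A \<inter> space M" "b = X 1 -` B \<inter> space M" "A \<in> sets borel" "B \<in> sets borel"
      by auto
    then show "a \<inter> b \<in> {X 1 -` A \<inter> space M |A. A \<in> sets borel}"
      by (intro CollectI exI[of _ "A \<inter> B"]) auto
  next
    fix a b assume "a \<in> {?Y -` A \<inter> space M |A. A \<in> sets borel}" "b \<in> {?Y -` A \<inter> space M |A. A \<in> sets borel}"
    then obtain A B where "a = ?Y -` A \<inter> space M" "b = ?Y -` B \<inter> space M" "A \<in> sets borel" "B \<in> sets borel"
      by auto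
    then show "a \<inter> b \<in> {?Y -` A \<inter> space M |A. A \<in> sets borel}"
      by (intro CollectI exI[of _ "A \<inter> B"]) auto
  qed measurable
qed

end

theory Submission
  imports Defs
begin

text \<open>
  From a state \<open>x \<ge> 1\<close> one step of the walk has the law \<open>\<delta>\<^sub>x \<triangle> \<delta>\<^sub>1\<close>: the walk stays at \<open>x\<close> with
  probability \<open>1 - 1 / x\<close>, and otherwise it moves to a point drawn from the Pareto law
  dilated by \<open>x\<close>, which has no atoms. Dependence is detected by the event that the increment
  vanishes: conditionally on \<open>X k = x\<close> this event has probability \<open>1 - 1 / x\<close>
  (\<open>emeasure_stay\<close>). If the increment were independent of \<open>X k\<close>, this conditional probability
  would be almost surely constant, hence \<open>X k\<close> itself would be almost surely constant. For
  \<open>k \<ge> 2\<close> it is not (\<open>not_AE_constant\<close>): the step that leads to \<open>X k\<close> starts at some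
  \<open>x \<ge> 1\<close> and hits any given point with probability at most \<open>1 - 1 / x < 1\<close>.

  The increments cannot be independent either. Since \<open>X 1 = 1\<close> almost surely, the first
  increment \<open>X 2 - X 1\<close> determines \<open>X 2\<close> almost surely, so its independence of \<open>X 3 - X 2\<close>
  would give the case \<open>k = 2\<close> excluded above. The argument is therefore carried out in
  \<open>not_indep_increment\<close> for any variable that is almost surely equal to \<open>X k\<close>.

  The event \<open>X (k + 1) = X k\<close> concerns both states at once, while the transition
  probabilities describe \<open>X (k + 1) \<in> B\<close> for one Borel set \<open>B\<close> at a time. The bridge is
  \<open>emeasure_pair_kernel\<close>: the joint law of two variables is determined on rectangles.
\<close>

section \<open>One step of the Kendall kernel\<close>

lemma prob_space_dilation_pareto2: "prob_space (dilation b pareto2)"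
  unfolding dilation_def by (rule prob_space.prob_space_distr[OF prob_space_pareto2]) measurable

lemma emeasure_dilation_pareto2_singleton:
  assumes "b \<noteq> 0"
  shows "emeasure (dilation b pareto2) {c} = 0"
proof -
  have "(\<lambda>x. b * x) -` {c} = {c / b}"
    using assms by (auto simp: field_simps)
  moreover have "emeasure pareto2 {c / b} = 0"
    unfolding pareto2_def
    by (subst emeasure_density) (auto simp: nn_integral_0_iff_AE intro!: AE_I[of _ _ "{c / b}"])
  ultimately show ?thesis
    by (simp add: dilation_def emeasure_distr)
qed

text \<open>
  Together with \<open>X 1 = 1\<close> this keeps the walk in \<open>{1..}\<close>, where the holding probability
  \<open>1 - 1 / x\<close> is injective in \<open>x\<close> and less than 1.
\<close>

lemma emeasure_dilation_pareto2_atLeast: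
  assumes "1 \<le> b"
  shows "emeasure (dilation b pareto2) {1..} = 1"
proof -
  interpret prob_space "dilation b pareto2"
    by (rule prob_space_dilation_pareto2)
  have "AE x in pareto2. 1 < x"
    unfolding pareto2_def by (subst AE_density) (auto simp: indicator_def)
  then have "AE x in pareto2. b * x \<in> {1..}"
  proof eventually_elim
    case (elim x)
    then show ?case
      using mult_mono[of 1 b 1 x] assms by simp
  qed
  then have "AE x in dilation b pareto2. x \<in> {1..}"
    unfolding dilation_def by (subst AE_distr_iff) auto
  then show ?thesis
    by (intro emeasure_eq_1_AE) (auto simp: dilation_def)
qed

lemma prob_space_kendall_dirac: "prob_space (kendall_dirac x y)"
proof
  define p where "p = min 1 (max 0 (min x y / max x y))"
  have "emeasure (kendall_dirac x y) UNIV = ennreal p + ennreal (1 - p)"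
    using prob_space.emeasure_space_1[OF prob_space_dilation_pareto2, of "max x y"]
    by (simp add: emeasure_kendall_dirac_aux[OF _ p_def] dilation_def)
  also have "\<dots> = 1"
    by (subst ennreal_plus[symmetric]) (auto simp: p_def)
  finally show "emeasure (kendall_dirac x y) (space (kendall_dirac x y)) = 1"
    by (simp add: sets_eq_imp_space_eq[OF sets_kendall_dirac])
qed

text \<open>
  Only the part of the mixture that stays at \<open>x\<close> charges points. For \<open>c = x\<close> this is the
  probability of a zero increment; for arbitrary \<open>c\<close> it bounds the atoms of the next state.
\<close>

lemma emeasure_kendall_dirac_singleton:
  assumes "1 \<le> x"
  shows "emeasure (kendall_dirac x 1) {c} = ennreal (1 - 1 / x) * indicator {c} x"
  using assms unfolding kendall_dirac_commute[of x]
  by (simp add: emeasure_kendall_dirac emeasure_dilation_pareto2_singleton indicator_def)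

lemma emeasure_kendall_dirac_atLeast:
  assumes "1 \<le> x"
  shows "emeasure (kendall_dirac x 1) {1..} = 1"
  using assms unfolding kendall_dirac_commute[of x]
  by (simp add: emeasure_kendall_dirac emeasure_dilation_pareto2_atLeast flip: ennreal_plus)

section \<open>Joint laws from transition kernels\<close>

text \<open>
  If \<open>K\<close> describes the conditional law of \<open>V\<close> given \<open>U\<close> on each Borel set separately, it
  describes the joint law of \<open>(U, V)\<close> on every product measurable set, such as the diagonal.
  Both sides of the conclusion are finite measures in \<open>C\<close>, and \<open>rect\<close> says that they agree on
  the rectangles, which form an intersection-stable generator.
\<close>

lemma (in prob_space) emeasure_pair_kernel:
  fixes U V :: "'a \<Rightarrow> real"
  assumes [measurable]: "random_variable borel U" "random_variable borel V"
    and K [measurable]: "K \<in> borel \<rightarrow>\<^sub>M subprob_algebra borel"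
    and rect: "\<And>A B. A \<in> sets borel \<Longrightarrow> B \<in> sets borel \<Longrightarrow>
      emeasure M {\<omega> \<in> space M. U \<omega> \<in> A \<and> V \<omega> \<in> B} =
        (\<integral>\<^sup>+\<omega>. indicator A (U \<omega>) * emeasure (K (U \<omega>)) B \<partial>M)"
    and C: "C \<in> sets (borel \<Otimes>\<^sub>M borel)"
  shows "emeasure M {\<omega> \<in> space M. (U \<omega>, V \<omega>) \<in> C} =
    (\<integral>\<^sup>+\<omega>. emeasure (K (U \<omega>)) (Pair (U \<omega>) -` C) \<partial>M)"
proof -
  \<comment> \<open>\<open>L x\<close> is \<open>K x\<close> moved to the fibre over \<open>x\<close>; mixing it over the law of \<open>U\<close> gives the
    right-hand side as a measure.\<close>
  define L where "L x = distr (K x) (borel \<Otimes>\<^sub>M borel) (Pair x)" for x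
  have sets_K: "sets (K x) = sets borel" for x
    using measurable_space[OF K, of x] by (simp add: space_subprob_algebra)
  have L [measurable]: "L \<in> borel \<rightarrow>\<^sub>M subprob_algebra (borel \<Otimes>\<^sub>M borel)"
    unfolding L_def by (rule measurable_distr2[where M=borel]) measurable
  have L_app: "emeasure (L x) D = emeasure (K x) (Pair x -` D)" if "D \<in> sets (borel \<Otimes>\<^sub>M borel)" for x D
    unfolding L_def using that
    by (subst emeasure_distr) (auto simp: measurable_cong_sets[OF sets_K refl] sets_eq_imp_space_eq[OF sets_K])
  have bind_app: "emeasure (M \<bind> (\<lambda>\<omega>. L (U \<omega>))) D = (\<integral>\<^sup>+\<omega>. emeasure (K (U \<omega>)) (Pair (U \<omega>) -` D) \<partial>M)"
    if "D \<in> sets (borel \<Otimes>\<^sub>M borel)" for D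
    using that by (subst emeasure_bind[where N="borel \<Otimes>\<^sub>M borel"]) (auto simp: not_empty L_app)
  have "distr M (borel \<Otimes>\<^sub>M borel) (\<lambda>\<omega>. (U \<omega>, V \<omega>)) = M \<bind> (\<lambda>\<omega>. L (U \<omega>))"
  proof (rule measure_eqI_generator_eq[OF Int_stable_pair_measure_generator])
    show "{a \<times> b |a b. a \<in> sets borel \<and> b \<in> sets borel} \<subseteq> Pow (UNIV :: (real \<times> real) set)"
      by simp
    show "sets (distr M (borel \<Otimes>\<^sub>M borel) (\<lambda>\<omega>. (U \<omega>, V \<omega>))) =
        sigma_sets UNIV {a \<times> b |a b. a \<in> sets (borel :: real measure) \<and> b \<in> sets (borel :: real measure)}"
      by (simp add: sets_pair_measure)
    show "sets (M \<bind> (\<lambda>\<omega>. L (U \<omega>))) =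
        sigma_sets UNIV {a \<times> b |a b. a \<in> sets (borel :: real measure) \<and> b \<in> sets (borel :: real measure)}"
      by (subst sets_bind[where N="borel \<Otimes>\<^sub>M borel"])
         (auto simp: L_def not_empty sets_pair_measure)
    show "range (\<lambda>_ :: nat. UNIV \<times> UNIV) \<subseteq>
        {a \<times> b |a b. a \<in> sets (borel :: real measure) \<and> b \<in> sets (borel :: real measure)}"
      by (auto intro!: exI[of _ UNIV])
    show "(\<Union>i :: nat. UNIV \<times> UNIV) = (UNIV :: (real \<times> real) set)"
      by simp
    show "emeasure (distr M (borel \<Otimes>\<^sub>M borel) (\<lambda>\<omega>. (U \<omega>, V \<omega>))) (UNIV \<times> UNIV) \<noteq> \<infinity>"
      by (simp add: finite_measure.emeasure_finite[OF finite_measure_distr])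
    fix D :: "(real \<times> real) set"
    assume "D \<in> {a \<times> b |a b. a \<in> sets borel \<and> b \<in> sets borel}"
    then obtain A B where D: "D = A \<times> B" and [measurable]: "A \<in> sets borel" "B \<in> sets borel"
      by auto
    have "emeasure (distr M (borel \<Otimes>\<^sub>M borel) (\<lambda>\<omega>. (U \<omega>, V \<omega>))) D =
        emeasure M {\<omega> \<in> space M. U \<omega> \<in> A \<and> V \<omega> \<in> B}"
      unfolding D by (subst emeasure_distr) (auto intro!: arg_cong2[where f=emeasure])
    also have "\<dots> = (\<integral>\<^sup>+\<omega>. indicator A (U \<omega>) * emeasure (K (U \<omega>)) B \<partial>M)"
      by (rule rect) measurable
    also have "\<dots> = emeasure (M \<bind> (\<lambda>\<omega>. L (U \<omega>))) D"
      unfolding D by (subst bind_app) (auto intro!: nn_integral_cong simp: indicator_def)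
    finally show "emeasure (distr M (borel \<Otimes>\<^sub>M borel) (\<lambda>\<omega>. (U \<omega>, V \<omega>))) D =
        emeasure (M \<bind> (\<lambda>\<omega>. L (U \<omega>))) D" .
  qed
  then have "emeasure (distr M (borel \<Otimes>\<^sub>M borel) (\<lambda>\<omega>. (U \<omega>, V \<omega>))) C =
      (\<integral>\<^sup>+\<omega>. emeasure (K (U \<omega>)) (Pair (U \<omega>) -` C) \<partial>M)"
    using bind_app[OF C] by simp
  then show ?thesis
    using C by (subst (asm) emeasure_distr) (auto simp: vimage_def Int_def conj_commute)
qed

section \<open>The walk with unit steps\<close>

locale unit_kendall_walk = kendall_walk M "return borel 1" X
  for M :: "'a measure" and X
begin

declare random_variable [measurable]

text \<open>
  The transition probabilities integrated over \<open>{X k \<in> A}\<close>, an event of the history up to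
  time \<open>k\<close>.
\<close>

lemma transition_rectangle:
  assumes [measurable]: "A \<in> sets borel" "B \<in> sets borel"
  shows "emeasure M {\<omega> \<in> space M. X k \<omega> \<in> A \<and> X (Suc k) \<omega> \<in> B} =
    (\<integral>\<^sup>+\<omega>. indicator A (X k \<omega>) * emeasure (kendall_dirac (X k \<omega>) 1) B \<partial>M)"
proof -
  interpret F: finite_measure_subalgebra M "history M X k"
    by standard (rule subalgebra_history[OF random_variable])
  let ?A = "X k -` A \<inter> space M" and ?B = "X (Suc k) -` B \<inter> space M"
  let ?p = "\<lambda>\<omega>. measure (kendall_dirac (X k \<omega>) 1) B"
  have [measurable]: "?A \<in> events" "?B \<in> events"
    by measurable
  have A: "?A \<in> sets (history M X k)"
    unfolding history_def by (subst sets_measure_of) (fastforce intro!: sigma_sets.Basic)+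
  have K [measurable]: "(\<lambda>x. kendall_dirac x 1) \<in> borel \<rightarrow>\<^sub>M subprob_algebra borel"
    using measurable_kendall_dirac_snd[of 1] unfolding kendall_dirac_commute[of 1] .
  have [measurable]: "?p \<in> borel_measurable M"
    unfolding measure_def by measurable
  have p: "0 \<le> ?p \<omega>" "?p \<omega> \<le> 1" for \<omega>
    using prob_space.prob_le_1[OF prob_space_kendall_dirac] by auto
  \<comment> \<open>The first power of the step is \<open>\<delta>\<^sub>0 \<triangle> \<delta>\<^sub>1 = \<delta>\<^sub>1\<close>.\<close>
  have "AE \<omega> in M. real_cond_exp M (history M X k) (indicator ?B) \<omega> = ?p \<omega>"
    using transition[of k "Suc k" B]
    by (simp add: kendall_conv_return kendall_dirac_0)
  then have "(\<integral>\<omega>\<in>?A. indicator ?B \<omega> \<partial>M) = (\<integral>\<omega>\<in>?A. ?p \<omega> \<partial>M)"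
    using A by (subst F.real_cond_exp_intA)
      (auto simp: set_lebesgue_integral_def emeasure_eq_measure intro!: integral_cong_AE)
  also have "(\<integral>\<omega>\<in>?A. indicator ?B \<omega> \<partial>M) = prob (?A \<inter> ?B)"
    by (simp add: set_lebesgue_integral_def flip: indicator_inter_arith)
  also have "?A \<inter> ?B = {\<omega> \<in> space M. X k \<omega> \<in> A \<and> X (Suc k) \<omega> \<in> B}"
    by auto
  finally have "emeasure M {\<omega> \<in> space M. X k \<omega> \<in> A \<and> X (Suc k) \<omega> \<in> B} =
      ennreal (\<integral>\<omega>. indicator ?A \<omega> * ?p \<omega> \<partial>M)"
    by (simp add: emeasure_eq_measure set_lebesgue_integral_def)
  also have "\<dots> = (\<integral>\<^sup>+\<omega>. ennreal (indicator ?A \<omega> * ?p \<omega>) \<partial>M)"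
    using p by (intro nn_integral_eq_integral[symmetric] integrable_const_bound[where B=1])
      (auto simp: indicator_def)
  also have "\<dots> = (\<integral>\<^sup>+\<omega>. indicator A (X k \<omega>) * emeasure (kendall_dirac (X k \<omega>) 1) B \<partial>M)"
    using prob_space_kendall_dirac
    by (intro nn_integral_cong)
       (auto simp: indicator_def prob_space_def finite_measure.emeasure_eq_measure)
  finally show ?thesis .
qed

lemma transition_pair:
  assumes "C \<in> sets (borel \<Otimes>\<^sub>M borel)"
  shows "emeasure M {\<omega> \<in> space M. (X k \<omega>, X (Suc k) \<omega>) \<in> C} =
    (\<integral>\<^sup>+\<omega>. emeasure (kendall_dirac (X k \<omega>) 1) (Pair (X k \<omega>) -` C) \<partial>M)"
proof (rule emeasure_pair_kernel[OF random_variable random_variable _ transition_rectangle assms])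
  show "(\<lambda>x. kendall_dirac x 1) \<in> borel \<rightarrow>\<^sub>M subprob_algebra borel"
    using measurable_kendall_dirac_snd[of 1] unfolding kendall_dirac_commute[of 1] .
qed

lemma AE_ge_1: "AE \<omega> in M. 1 \<le> X (Suc k) \<omega>"
proof (induction k)
  case 0
  then show ?case
    using kendall_walk_X1[OF kendall_walk_axioms] by eventually_elim simp
next
  case (Suc k)
  have "emeasure M {\<omega> \<in> space M. X (Suc k) \<omega> \<in> UNIV \<and> X (Suc (Suc k)) \<omega> \<in> {1..}} =
      (\<integral>\<^sup>+\<omega>. indicator UNIV (X (Suc k) \<omega>) * emeasure (kendall_dirac (X (Suc k) \<omega>) 1) {1..} \<partial>M)"
    by (rule transition_rectangle) auto
  also have "\<dots> = (\<integral>\<^sup>+\<omega>. 1 \<partial>M)"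
    using Suc by (intro nn_integral_cong_AE) (auto elim!: eventually_mono simp: emeasure_kendall_dirac_atLeast)
  also have "\<dots> = 1"
    by (simp add: emeasure_space_1)
  finally have "prob {\<omega> \<in> space M. 1 \<le> X (Suc (Suc k)) \<omega>} = 1"
    by (simp add: emeasure_eq_measure)
  then show ?case
    by (subst (asm) prob_Collect_eq_1) auto
qed

text \<open>
  Given \<open>X (Suc k) = x\<close>, the next state equals \<open>c\<close> with probability \<open>1 - 1 / c\<close> if \<open>x = c\<close> and
  with probability 0 otherwise.
\<close>

lemma not_AE_constant: "\<not> (AE \<omega> in M. X (Suc (Suc k)) \<omega> = c)"
proof
  assume "AE \<omega> in M. X (Suc (Suc k)) \<omega> = c"
  then have "1 = emeasure M {\<omega> \<in> space M. X (Suc k) \<omega> \<in> UNIV \<and> X (Suc (Suc k)) \<omega> \<in> {c}}"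
    by (subst emeasure_eq_1_AE) auto
  also have "\<dots> = (\<integral>\<^sup>+\<omega>. indicator UNIV (X (Suc k) \<omega>) * emeasure (kendall_dirac (X (Suc k) \<omega>) 1) {c} \<partial>M)"
    by (rule transition_rectangle) auto
  also have "\<dots> \<le> (\<integral>\<^sup>+\<omega>. ennreal (1 - 1 / c) * indicator {1..} c \<partial>M)"
    using AE_ge_1[of k]
    by (intro nn_integral_mono_AE)
       (auto elim!: eventually_mono simp: emeasure_kendall_dirac_singleton indicator_def)
  also have "\<dots> < 1"
    by (auto simp: emeasure_space_1 indicator_def ennreal_less_one_iff)
  finally show False by simp
qed

text \<open>
  For each state \<open>x\<close>, the section of the diagonal at \<open>x\<close> is the atom \<open>{x}\<close> of the kernel.
\<close>

lemma emeasure_stay: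
  assumes [measurable]: "A \<in> sets borel"
  shows "emeasure M {\<omega> \<in> space M. X (Suc k) \<omega> \<in> A \<and> X (Suc (Suc k)) \<omega> = X (Suc k) \<omega>} =
    (\<integral>\<^sup>+\<omega>. ennreal (1 - 1 / X (Suc k) \<omega>) * indicator A (X (Suc k) \<omega>) \<partial>M)"
proof -
  let ?C = "{z \<in> space (borel \<Otimes>\<^sub>M borel). fst z \<in> A \<and> snd z = (fst z :: real)}"
  have "{\<omega> \<in> space M. X (Suc k) \<omega> \<in> A \<and> X (Suc (Suc k)) \<omega> = X (Suc k) \<omega>} =
      {\<omega> \<in> space M. (X (Suc k) \<omega>, X (Suc (Suc k)) \<omega>) \<in> ?C}"
    by (auto simp: space_pair_measure)
  also have "emeasure M \<dots> =
      (\<integral>\<^sup>+\<omega>. emeasure (kendall_dirac (X (Suc k) \<omega>) 1) (Pair (X (Suc k) \<omega>) -` ?C) \<partial>M)"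
    by (rule transition_pair) measurable
  also have "\<dots> = (\<integral>\<^sup>+\<omega>. ennreal (1 - 1 / X (Suc k) \<omega>) * indicator A (X (Suc k) \<omega>) \<partial>M)"
  proof (intro nn_integral_cong_AE)
    show "AE \<omega> in M. emeasure (kendall_dirac (X (Suc k) \<omega>) 1) (Pair (X (Suc k) \<omega>) -` ?C) =
        ennreal (1 - 1 / X (Suc k) \<omega>) * indicator A (X (Suc k) \<omega>)"
      using AE_ge_1[of k]
    proof eventually_elim
      case (elim \<omega>)
      have "Pair (X (Suc k) \<omega>) -` ?C = (if X (Suc k) \<omega> \<in> A then {X (Suc k) \<omega>} else {})"
        by (auto simp: space_pair_measure)
      then show ?case
        using elim by (simp add: emeasure_kendall_dirac_singleton)
    qed
  qed
  finally show ?thesis .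
qed

text \<open>
  Under independence the conditional probability \<open>1 - 1 / X (Suc (Suc k))\<close> of a zero increment
  coincides with the unconditional one, \<open>p\<close>, so the state would be the constant
  \<open>1 / (1 - p)\<close>. Passing to \<open>Z\<close> allows the state to be replaced by a function of
  the preceding increment when \<open>k = 0\<close>.
\<close>

lemma not_indep_increment:
  assumes Z: "AE \<omega> in M. Z \<omega> = X (Suc (Suc k)) \<omega>"
    and indep: "indep_var borel Z borel (\<lambda>\<omega>. X (Suc (Suc (Suc k))) \<omega> - X (Suc (Suc k)) \<omega>)"
  shows False
proof -
  let ?V = "X (Suc (Suc k))" and ?W = "X (Suc (Suc (Suc k)))"
  have [measurable]: "Z \<in> borel_measurable M"
    using indep by (rule indep_var_rv1)
  define p where "p = prob {\<omega> \<in> space M. ?W \<omega> - ?V \<omega> \<in> {0}}"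
  \<comment> \<open>The maximum extends \<open>1 - 1 / x - p\<close> from \<open>{1..}\<close>, where the state lives, to a bounded and
    hence integrable function on the whole line.\<close>
  define f where "f x = 1 - 1 / max 1 x - p" for x :: real
  have f [measurable]: "f \<in> borel_measurable borel"
    unfolding f_def by measurable
  let ?D = "distr M borel ?V"
  interpret D: prob_space ?D
    by (rule prob_space_distr) measurable
  have f_bound: "\<bar>f x\<bar> \<le> 1" for x
  proof -
    have "0 \<le> 1 / max 1 x" "1 / max 1 x \<le> 1" "0 \<le> p" "p \<le> 1"
      by (auto simp: p_def)
    then show ?thesis
      unfolding f_def by linarith
  qed
  have int: "integrable ?D f"
    using f_bound by (intro D.integrable_const_bound[where B=1]) auto
  have "AE x in ?D. f x = 0"
  proof (rule D.density_zero[OF int])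
    fix A assume "A \<in> sets ?D"
    then have A [measurable]: "A \<in> sets borel"
      by simp
    have [measurable]: "(\<lambda>\<omega>. 1 - 1 / max 1 (?V \<omega>)) \<in> borel_measurable M"
      by measurable
    have bound: "0 \<le> 1 - 1 / max 1 x" "1 - 1 / max 1 x \<le> 1" for x :: real
      by auto
    have intA: "integrable M (\<lambda>\<omega>. (1 - 1 / max 1 (?V \<omega>)) * indicator A (?V \<omega>))"
      using bound by (intro integrable_const_bound[where B=1]) (auto simp: indicator_def)
    have "ennreal (prob {\<omega> \<in> space M. ?V \<omega> \<in> A \<and> ?W \<omega> = ?V \<omega>}) =
        (\<integral>\<^sup>+\<omega>. ennreal ((1 - 1 / max 1 (?V \<omega>)) * indicator A (?V \<omega>)) \<partial>M)"
      unfolding emeasure_eq_measure[symmetric] emeasure_stay[OF A] using AE_ge_1[of "Suc k"]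
      by (intro nn_integral_cong_AE) (auto elim!: eventually_mono simp: indicator_def max_def)
    also have "\<dots> = ennreal (\<integral>\<omega>. (1 - 1 / max 1 (?V \<omega>)) * indicator A (?V \<omega>) \<partial>M)"
      using bound by (intro nn_integral_eq_integral intA) (auto simp: indicator_def)
    finally have stay: "prob {\<omega> \<in> space M. ?V \<omega> \<in> A \<and> ?W \<omega> = ?V \<omega>} =
        (\<integral>\<omega>. (1 - 1 / max 1 (?V \<omega>)) * indicator A (?V \<omega>) \<partial>M)"
      using bound by (subst (asm) ennreal_inj) (auto intro!: integral_nonneg_AE simp: indicator_def)
    have "prob {\<omega> \<in> space M. ?V \<omega> \<in> A \<and> ?W \<omega> = ?V \<omega>} =
        prob ((\<lambda>\<omega>. (Z \<omega>, ?W \<omega> - ?V \<omega>)) -` (A \<times> {0}) \<inter> space M)"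
      using Z by (intro finite_measure_eq_AE) (auto elim!: eventually_mono)
    also have "\<dots> = prob (Z -` A \<inter> space M) * prob ((\<lambda>\<omega>. ?W \<omega> - ?V \<omega>) -` {0} \<inter> space M)"
      by (rule indep_varD[OF indep]) auto
    also have "prob (Z -` A \<inter> space M) = prob (?V -` A \<inter> space M)"
      using Z by (intro finite_measure_eq_AE) (auto elim!: eventually_mono)
    also have "prob ((\<lambda>\<omega>. ?W \<omega> - ?V \<omega>) -` {0} \<inter> space M) = p"
      unfolding p_def by (auto intro!: arg_cong[where f=prob])
    also have "prob (?V -` A \<inter> space M) = (\<integral>\<omega>. indicator A (?V \<omega>) \<partial>M)"
      by (simp add: integral_indicator[symmetric] indicator_vimage[symmetric] del: integral_indicator)
    finally have "(\<integral>\<omega>. (1 - 1 / max 1 (?V \<omega>)) * indicator A (?V \<omega>) \<partial>M) =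
        (\<integral>\<omega>. p * indicator A (?V \<omega>) \<partial>M)"
      unfolding stay by simp
    moreover have "integrable M (\<lambda>\<omega>. p * indicator A (?V \<omega>))"
      by (intro integrable_const_bound[where B="\<bar>p\<bar>"]) (auto simp: indicator_def)
    ultimately have "(\<integral>\<omega>. (1 - 1 / max 1 (?V \<omega>)) * indicator A (?V \<omega>) - p * indicator A (?V \<omega>) \<partial>M) = 0"
      using intA by (subst Bochner_Integration.integral_diff) auto
    then show "set_lebesgue_integral ?D A f = 0"
      by (simp add: set_lebesgue_integral_def integral_distr f_def algebra_simps)
  qed
  then have "AE \<omega> in M. f (?V \<omega>) = 0"
    by (subst (asm) AE_distr_iff) auto
  then have "AE \<omega> in M. ?V \<omega> = 1 / (1 - p)"
    using AE_ge_1[of "Suc k"]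
  proof eventually_elim
    case (elim \<omega>)
    then have "1 - p = 1 / ?V \<omega>"
      by (simp add: f_def max_def)
    then show ?case
      by simp
  qed
  then show False
    using not_AE_constant by blast
qed

lemma not_indep_state_increment:
  assumes "2 \<le> k"
  shows "\<not> indep_var borel (X k) borel (\<lambda>\<omega>. X (k + 1) \<omega> - X k \<omega>)"
proof -
  obtain j where "k = Suc (Suc j)"
    using assms by (auto simp: le_iff_add)
  then show ?thesis
    using not_indep_increment[of "X k" j] by auto
qed

text \<open>
  Only the first two increments are used: \<open>1 + (X 2 - X 1)\<close> is a version of \<open>X 2\<close>.
\<close>

lemma not_indep_increments:
  "\<not> indep_vars (\<lambda>_. borel) (\<lambda>n \<omega>. X (n + 1) \<omega> - X n \<omega>) {1..}"
proof
  let ?Y = "\<lambda>n \<omega>. X (n + 1) \<omega> - X n \<omega>"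
  assume "indep_vars (\<lambda>_. borel) ?Y {1..}"
  then have "indep_vars (\<lambda>_. borel) ?Y {1, 2}"
    by (rule indep_vars_subset) auto
  from indep_vars_sum[OF _ _ this]
  have "indep_var borel (?Y 1) borel (?Y 2)"
    by simp
  then have "indep_var borel ((\<lambda>y. 1 + y) \<circ> ?Y 1) borel ((\<lambda>y. y) \<circ> ?Y 2)"
    by (rule indep_var_compose) auto
  moreover have "AE \<omega> in M. ((\<lambda>y. 1 + y) \<circ> ?Y 1) \<omega> = X (Suc (Suc 0)) \<omega>"
    using kendall_walk_X1[OF kendall_walk_axioms] by eventually_elim (simp add: numeral_2_eq_2)
  ultimately show False
    using not_indep_increment[of "(\<lambda>y. 1 + y) \<circ> ?Y 1" 0] by (simp add: o_def numeral_2_eq_2)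
qed

end

theorem proposition3p8:
  fixes M :: "'a measure" and X :: "nat \<Rightarrow> 'a \<Rightarrow> real"
  assumes "kendall_walk M (return borel 1) X"
  shows "\<not> prob_space.indep_vars M (\<lambda>_. borel) (\<lambda>n \<omega>. X (n + 1) \<omega> - X n \<omega>) {1..} \<and>
    (\<forall>k\<ge>2. \<not> prob_space.indep_var M borel (X k) borel (\<lambda>\<omega>. X (k + 1) \<omega> - X k \<omega>))"
proof -
  interpret kendall_walk M "return borel 1" X by fact
  interpret unit_kendall_walk M X ..
  show ?thesis
    using not_indep_increments not_indep_state_increment by blast
qed

end
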